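(* Let $A$ be the adjacency matrix of an $\mathrm{SRG}(v,k,\lambda,\mu)$ with $0<k<v-1$, and let $n=v$. There exist $\beta>0$ and a positive integer $m$ such that $G=2\beta A+(\beta+1)I-\beta J$ is the Gram matrix of an ETF $\{\varphi_i\}_{i=1}^n$ for $\mathbb{R}^m$ if and only if $v=4k-2\lambda-2\mu$. Moreover, in this case $\beta$ and $m$ are unique: if $v-2k-1>0$ then this ETF is centered and $$m=\tfrac{v(v-2k-1)^2}{(v-1)+(v-2k-1)^2},\quad \alpha=\tfrac nm=\tfrac{v-1}{(v-2k-1)^2}+1,\quad \beta=\left[\tfrac{n-m}{m(n-1)}\right]^{1/2}=\tfrac1{v-2k-1};$$ if $v-2k-1<0$ then this ETF is axial and $$m=\tfrac{v(v-1)}{(v-1)+(v-2k-1)^2},\quad \alpha=\tfrac nm=\tfrac{(v-2k-1)^2}{v-1}+1,\quad \beta=\left[\tfrac{n-m}{m(n-1)}\right]^{1/2}=-\tfrac{v-2k-1}{v-1}.$$ Moreover, this method of converting an SRG with $v=4k-2\lambda-2\mu$ (and $0<k<v-1$) into the Gram matrix $G$ of a centroid-symmetric real ETF is the inverse of the method of converting a centered or axial ETF for $\mathbb{R}^m$ of $n>m$ vectors, with synthesis operator $\Phi$, into the SRG with adjacency matrix $$\tfrac1{2\beta_0}\Phi^*\Phi-\tfrac{\beta_0+1}{2\beta_0}I+\tfrac12J,\qquad \beta_0=\left[\tfrac{n-m}{m(n-1)}\right]^{1/2}.$$ That is, starting from such an ETF (whose associated SRG has $0<k<v-1$), passing to its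 SRG and then to $G$ recovers the Gram matrix $\Phi^*\Phi$; and starting from such an SRG with adjacency matrix $A$, passing to $G$ and then to the SRG of the resulting ETF recovers $A$.
   Context: For vectors $\{\varphi_i\}_{i=1}^n$ in $\mathbb{R}^m$, the synthesis operator $\Phi$ is the $m\times n$ matrix whose $i$th column is $\varphi_i$, and the Gram matrix is $\Phi^*\Phi$. The sequence is an equiangular tight frame (ETF) for $\mathbb{R}^m$ if every $\varphi_i$ has unit norm, $|\langle\varphi_i,\varphi_j\rangle|$ is constant over all $i\neq j$, and $\Phi\Phi^*=\alpha I$ for some $\alpha>0$ (necessarily $\alpha=\frac nm$). Let $\mathbf{1}$ be the all-ones vector, $J=\mathbf{1}\mathbf{1}^*$, and $I$ the identity matrix. An ETF is centered if $\mathbf{1}$ lies in the null space of $\Phi$ (equivalently $\Phi^*\Phi\mathbf{1}=\mathbf{0}$); it is axial if $\mathbf{1}$ lies in the column space of $\Phi^*$ (equivalently $\Phi^*\Phi\mathbf{1}=\frac nm\mathbf{1}$); it is centroid-symmetric (has centroidal symmetry) if it is centered or axial. A simple graph on $v$ vertices with adjacency matrix $A$ is an $\mathrm{SRG}(v,k,\lambda,\mu)$ (strongly regular graph) if it is $k$-regular and $A^2=(\lambda-\mu)A+(k-\mu)I+\mu J$; when $0<k<v-1$ this is equivalent to saying that the graph is $k$-regular, any two neighbors have exactly $\lambda$ common neighbors, and any two distinct nonneighbors have exactly $\mu$ common neighbors. It is known that for every centered or axial ETF of $n>m$ vectors for $\mathbb{R}^m$, the matrix $\frac1{2\beta_0}\Phi^*\Phi-\frac{\beta_0+1}{2\beta_0}I+\frac12J$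 is the adjacency matrix of an SRG on $v=n$ vertices with $v=4k-2\lambda-2\mu$. *)

theory Defs
  imports Complex_Main "Jordan_Normal_Form.VS_Connect" "Jordan_Normal_Form.Matrix_Kernel"
begin

text \<open>
  The ambient dimension \<open>m\<close> is existentially quantified in the main statement, so vectors and
  matrices are those of \<open>Jordan_Normal_Form\<close>, whose dimensions are natural numbers.
  A sequence of \<open>n\<close> vectors is a function on \<open>nat\<close> of which only the values at \<open>0, \<dots>, n - 1\<close>
  matter; likewise vertices are \<open>0, \<dots>, v - 1\<close>. All matrices are real, so adjoint is transpose.
\<close>

definition ones_vec :: "nat \<Rightarrow> real vec" where
  "ones_vec n = vec n (\<lambda>_. 1)"

definition J_mat :: "nat \<Rightarrow> real mat" where
  "J_mat n = mat n n (\<lambda>_. 1)"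

subsection \<open>Equiangular tight frames\<close>

definition synthesis :: "nat \<Rightarrow> nat \<Rightarrow> (nat \<Rightarrow> real vec) \<Rightarrow> real mat" where
  "synthesis m n \<phi> = mat_of_cols m (map \<phi> [0..<n])"

definition gram :: "nat \<Rightarrow> nat \<Rightarrow> (nat \<Rightarrow> real vec) \<Rightarrow> real mat" where
  "gram m n \<phi> = transpose_mat (synthesis m n \<phi>) * synthesis m n \<phi>"

definition tight_with_bound :: "nat \<Rightarrow> nat \<Rightarrow> (nat \<Rightarrow> real vec) \<Rightarrow> real \<Rightarrow> bool" where
  "tight_with_bound m n \<phi> \<alpha> \<longleftrightarrow>
     synthesis m n \<phi> * transpose_mat (synthesis m n \<phi>) = \<alpha> \<cdot>\<^sub>m 1\<^sub>m m"

definition etf :: "nat \<Rightarrow> nat \<Rightarrow> (nat \<Rightarrow> real vec) \<Rightarrow> bool" where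
  "etf m n \<phi> \<longleftrightarrow>
     (\<forall>i<n. \<phi> i \<in> carrier_vec m \<and> sqrt (\<phi> i \<bullet> \<phi> i) = 1) \<and>
     (\<exists>c. \<forall>i<n. \<forall>j<n. i \<noteq> j \<longrightarrow> \<bar>\<phi> i \<bullet> \<phi> j\<bar> = c) \<and>
     (\<exists>\<alpha>>0. tight_with_bound m n \<phi> \<alpha>)"

definition centered :: "nat \<Rightarrow> nat \<Rightarrow> (nat \<Rightarrow> real vec) \<Rightarrow> bool" where
  "centered m n \<phi> \<longleftrightarrow> ones_vec n \<in> mat_kernel (synthesis m n \<phi>)"

definition axial :: "nat \<Rightarrow> nat \<Rightarrow> (nat \<Rightarrow> real vec) \<Rightarrow> bool" where
  "axial m n \<phi> \<longleftrightarrow> ones_vec n \<in> vec_space.col_space n (transpose_mat (synthesis m n \<phi>))"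

definition centroid_symmetric :: "nat \<Rightarrow> nat \<Rightarrow> (nat \<Rightarrow> real vec) \<Rightarrow> bool" where
  "centroid_symmetric m n \<phi> \<longleftrightarrow> centered m n \<phi> \<or> axial m n \<phi>"

subsection \<open>Strongly regular graphs\<close>

text \<open>
  In \<open>srg v k l \<mu>\<close> the letter \<open>l\<close> is the parameter usually written as a lambda. Strong
  regularity is the matrix equation, which for \<open>0 < k < v - 1\<close> amounts to the common-neighbour
  counts but also admits the empty and complete graphs.
\<close>

definition simple_graph :: "nat \<Rightarrow> nat set set \<Rightarrow> bool" where
  "simple_graph v E \<longleftrightarrow> (\<forall>e\<in>E. e \<subseteq> {..<v} \<and> card e = 2)"

definition adj_mat :: "nat \<Rightarrow> nat set set \<Rightarrow> real mat" where
  "adj_mat v E = mat v v (\<lambda>(i, j). if {i, j} \<in> E then 1 else 0)"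

definition regular_graph :: "nat \<Rightarrow> nat \<Rightarrow> nat set set \<Rightarrow> bool" where
  "regular_graph v k E \<longleftrightarrow> (\<forall>i<v. card {j. j < v \<and> {i, j} \<in> E} = k)"

definition srg :: "nat \<Rightarrow> nat \<Rightarrow> nat \<Rightarrow> nat \<Rightarrow> nat set set \<Rightarrow> bool" where
  "srg v k l \<mu> E \<longleftrightarrow> simple_graph v E \<and> regular_graph v k E \<and>
     adj_mat v E * adj_mat v E =
       (real l - real \<mu>) \<cdot>\<^sub>m adj_mat v E + (real k - real \<mu>) \<cdot>\<^sub>m 1\<^sub>m v + real \<mu> \<cdot>\<^sub>m J_mat v"

definition srg_adjacency :: "nat \<Rightarrow> nat \<Rightarrow> nat \<Rightarrow> nat \<Rightarrow> real mat \<Rightarrow> bool" where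
  "srg_adjacency v k l \<mu> A \<longleftrightarrow> (\<exists>E. srg v k l \<mu> E \<and> A = adj_mat v E)"

subsection \<open>The two conversions\<close>

definition srg_gram :: "nat \<Rightarrow> real \<Rightarrow> real mat \<Rightarrow> real mat" where
  "srg_gram n \<beta> A = (2 * \<beta>) \<cdot>\<^sub>m A + (\<beta> + 1) \<cdot>\<^sub>m 1\<^sub>m n - \<beta> \<cdot>\<^sub>m J_mat n"

definition realizes :: "nat \<Rightarrow> real mat \<Rightarrow> real \<Rightarrow> nat \<Rightarrow> bool" where
  "realizes n A \<beta> m \<longleftrightarrow> \<beta> > 0 \<and> m > 0 \<and> (\<exists>\<phi>. etf m n \<phi> \<and> gram m n \<phi> = srg_gram n \<beta> A)"

text \<open>The common value of the off-diagonal Gram entries, up to sign, of an ETF (Welch bound).\<close>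

definition welch :: "nat \<Rightarrow> nat \<Rightarrow> real" where
  "welch m n = sqrt ((real n - real m) / (real m * (real n - 1)))"

definition etf_srg_mat :: "nat \<Rightarrow> nat \<Rightarrow> (nat \<Rightarrow> real vec) \<Rightarrow> real mat" where
  "etf_srg_mat m n \<phi> =
     (1 / (2 * welch m n)) \<cdot>\<^sub>m gram m n \<phi>
     - ((welch m n + 1) / (2 * welch m n)) \<cdot>\<^sub>m 1\<^sub>m n
     + (1 / 2) \<cdot>\<^sub>m J_mat n"

end

theory Submission
  imports Defs
begin

text \<open>
  Write \<open>G = I + \<beta>S\<close> with \<open>S = 2A + I - J\<close>, a symmetric matrix with zero diagonal and off-diagonal
  entries \<open>\<plusminus>1\<close>. A matrix \<open>G\<close> of this shape is the Gram matrix of an ETF iff \<open>G\<^sup>2 = \<alpha>G\<close> for some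
  \<open>\<alpha> > 0\<close>: then \<open>G / \<alpha>\<close> is an orthogonal projection, and an orthonormal basis of its range yields the
  vectors. Comparing the entries of \<open>G\<^sup>2 = \<alpha>G\<close> at an edge and at a nonedge forces
  \<open>v = 4k - 2l - 2\<mu>\<close>. Conversely, under this condition \<open>S\<^sup>2 = 2(l - \<mu> + 1)S + (v - 1)I\<close>, so \<open>S\<close>
  has just the two eigenvalues \<open>-r\<close> and \<open>(v - 1) / r\<close> of opposite sign, where \<open>r = v - 2k - 1\<close> and
  \<open>S1 = -r1\<close>; singularity of \<open>G\<close> determines \<open>\<beta>\<close>, and the sign of \<open>r\<close> decides whether the all-ones
  vector lies in the kernel or in the range of \<open>G\<close>.
\<close>

subsection \<open>Gram matrices of equiangular tight frames\<close>

lemma synthesis_carrier [simp]: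
  "synthesis m n \<phi> \<in> carrier_mat m n"
  "dim_row (synthesis m n \<phi>) = m" "dim_col (synthesis m n \<phi>) = n"
  unfolding synthesis_def using mat_of_cols_carrier[of m "map \<phi> [0..<n]"] by simp_all

lemma synthesis_index [simp]:
  "a < m \<Longrightarrow> i < n \<Longrightarrow> synthesis m n \<phi> $$ (a, i) = \<phi> i $ a"
  by (simp add: synthesis_def mat_of_cols_def)

lemma gram_carrier [simp]:
  "gram m n \<phi> \<in> carrier_mat n n" "dim_row (gram m n \<phi>) = n" "dim_col (gram m n \<phi>) = n"
  unfolding gram_def by (auto intro!: carrier_matI)

lemma gram_index:
  "i < n \<Longrightarrow> j < n \<Longrightarrow> gram m n \<phi> $$ (i, j) = (\<Sum>a<m. \<phi> i $ a * \<phi> j $ a)"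
  by (simp add: gram_def scalar_prod_def atLeast0LessThan)

lemma tight_with_bound_iff:
  "tight_with_bound m n \<phi> \<alpha> \<longleftrightarrow>
     (\<forall>a<m. \<forall>b<m. (\<Sum>i<n. \<phi> i $ a * \<phi> i $ b) = (if a = b then \<alpha> else 0))"
  unfolding tight_with_bound_def mat_eq_iff
  by (auto simp: scalar_prod_def atLeast0LessThan)

lemma inner_eq_gram:
  assumes "\<phi> i \<in> carrier_vec m" "\<phi> j \<in> carrier_vec m" "i < n" "j < n"
  shows "\<phi> i \<bullet> \<phi> j = gram m n \<phi> $$ (i, j)"
  using assms by (simp add: gram_index scalar_prod_def atLeast0LessThan)

text \<open>Apart from the ambient dimension and tightness, everything is read off the Gram matrix,
  so unit norms and equiangularity can be checked on a prescribed matrix.\<close>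

lemma etf_iff:
  "etf m n \<phi> \<longleftrightarrow>
     (\<forall>i<n. \<phi> i \<in> carrier_vec m) \<and> (\<forall>i<n. gram m n \<phi> $$ (i, i) = 1) \<and>
     (\<exists>c. \<forall>i<n. \<forall>j<n. i \<noteq> j \<longrightarrow> \<bar>gram m n \<phi> $$ (i, j)\<bar> = c) \<and>
     (\<exists>\<alpha>>0. tight_with_bound m n \<phi> \<alpha>)"
  unfolding etf_def using inner_eq_gram[of \<phi> _ m _ n] by (auto simp: all_conj_distrib)

lemma gram_symmetric: "i < n \<Longrightarrow> j < n \<Longrightarrow> gram m n \<phi> $$ (i, j) = gram m n \<phi> $$ (j, i)"
  by (simp add: gram_index mult.commute)

text \<open>With F the synthesis matrix, (F^T F)(F^T F) = F^T (F F^T) F, and tightness replaces the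
  inner product by \<alpha> I.\<close>

lemma gram_square:
  assumes "tight_with_bound m n \<phi> \<alpha>" "i < n" "j < n"
  shows "(\<Sum>t<n. gram m n \<phi> $$ (i, t) * gram m n \<phi> $$ (t, j)) = \<alpha> * gram m n \<phi> $$ (i, j)"
proof -
  let ?F = "synthesis m n \<phi>"
  have "gram m n \<phi> * gram m n \<phi> = transpose_mat ?F * (?F * transpose_mat ?F) * ?F"
    unfolding gram_def
    by (smt (verit, best) assoc_mult_mat mult_carrier_mat synthesis_carrier(1) transpose_carrier_mat)
  also have "\<dots> = \<alpha> \<cdot>\<^sub>m gram m n \<phi>"
    using assms(1) unfolding tight_with_bound_def gram_def
    by (smt (verit, best) mult_smult_assoc_mat mult_smult_distrib one_carrier_mat
        right_mult_one_mat synthesis_carrier(1) transpose_carrier_mat)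
  finally have "(gram m n \<phi> * gram m n \<phi>) $$ (i, j) = (\<alpha> \<cdot>\<^sub>m gram m n \<phi>) $$ (i, j)" by simp
  then show ?thesis using assms(2,3)
    by (simp add: scalar_prod_def atLeast0LessThan)
qed

section \<open>Trace, frame bound and Welch bound\<close>

text \<open>F^T F and F F^T have the same trace; unit norms make the first n and tightness makes the
  second m \<alpha>.\<close>

lemma tight_frame_trace:
  assumes "etf m n \<phi>" "tight_with_bound m n \<phi> \<alpha>"
  shows "real n = real m * \<alpha>"
proof -
  have "real n = (\<Sum>i<n. gram m n \<phi> $$ (i, i))"
    using assms(1) by (simp add: etf_iff)
  also have "\<dots> = (\<Sum>i<n. \<Sum>a<m. \<phi> i $ a * \<phi> i $ a)"
    by (simp add: gram_index)
  also have "\<dots> = (\<Sum>a<m. \<Sum>i<n. \<phi> i $ a * \<phi> i $ a)"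
    by (rule sum.swap)
  also have "\<dots> = real m * \<alpha>"
    using assms(2) by (simp add: tight_with_bound_iff)
  finally show ?thesis .
qed

lemma etf_dim_pos: "etf m n \<phi> \<Longrightarrow> 0 < n \<Longrightarrow> 0 < m"
  using tight_frame_trace[of m n \<phi>] unfolding etf_iff by (metis mult_zero_left neq0_conv of_nat_0 of_nat_eq_0_iff)

lemma tight_bound_eq:
  assumes "etf m n \<phi>" "tight_with_bound m n \<phi> \<alpha>" "0 < n"
  shows "\<alpha> = real n / real m"
  using tight_frame_trace[OF assms(1,2)] etf_dim_pos[OF assms(1,3)] by (simp add: field_simps)

lemma etf_tight:
  assumes "etf m n \<phi>" "0 < n"
  shows "tight_with_bound m n \<phi> (real n / real m)"
  using assms tight_bound_eq[OF assms(1) _ assms(2)] by (metis etf_iff)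

text \<open>Entry (0,0) of G G = (n/m) G says that the squares in row 0, one equal to 1 and n - 1
  equal to \<open>c\<^sup>2\<close>, add up to n/m. Solving for the nonnegative c gives the Welch
  value.\<close>

lemma equiangular_bound:
  assumes "etf m n \<phi>" "1 < n" "0 \<le> c"
    and "\<And>i j. i < n \<Longrightarrow> j < n \<Longrightarrow> i \<noteq> j \<Longrightarrow> \<bar>gram m n \<phi> $$ (i, j)\<bar> = c"
  shows "real n / real m = 1 + (real n - 1) * c\<^sup>2" and "c = welch m n"
proof -
  have m: "0 < m" using etf_dim_pos assms by auto
  let ?G = "\<lambda>i j. gram m n \<phi> $$ (i, j)"
  have d: "?G i i = 1" if "i < n" for i using assms(1) that by (auto simp: etf_iff)
  have "real n / real m = (\<Sum>t<n. ?G 0 t * ?G t 0)"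
    using gram_square[OF etf_tight[OF assms(1)], of 0 0] assms(2) d by simp
  also have "\<dots> = (\<Sum>t<n. (?G 0 t)\<^sup>2)"
    using assms(2) by (intro sum.cong refl) (simp add: power2_eq_square gram_symmetric[of 0])
  also have "\<dots> = (?G 0 0)\<^sup>2 + (\<Sum>t\<in>{..<n} - {0}. (?G 0 t)\<^sup>2)"
    using assms(2) by (intro sum.remove) auto
  also have "(\<Sum>t\<in>{..<n} - {0}. (?G 0 t)\<^sup>2) = (\<Sum>t\<in>{..<n} - {0}. c\<^sup>2)"
  proof (intro sum.cong refl)
    fix t assume "t \<in> {..<n} - {0}"
    then have "\<bar>?G 0 t\<bar> = c" using assms(2,4) by simp
    then show "(?G 0 t)\<^sup>2 = c\<^sup>2" by (metis power2_abs)
  qed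
  also have "\<dots> = (real n - 1) * c\<^sup>2"
    using assms(2) by (simp add: of_nat_diff)
  finally show *: "real n / real m = 1 + (real n - 1) * c\<^sup>2" using d assms(2) by simp
  have "(real n - real m) / (real m * (real n - 1)) = (real n / real m - 1) / (real n - 1)"
    using m by (simp add: field_simps)
  also have "\<dots> = c\<^sup>2" using * assms(2) by simp
  finally show "c = welch m n" using assms(3) by (simp add: welch_def)
qed

section \<open>Centering and axiality as row sums of the Gram matrix\<close>

lemma sum_of_squares_eq_0:
  fixes f :: "nat \<Rightarrow> real"
  shows "(\<Sum>a<m. f a * f a) = 0 \<longleftrightarrow> (\<forall>a<m. f a = 0)"
  by (auto simp: sum_nonneg_eq_0_iff)

lemma centered_iff:
  "centered m n \<phi> \<longleftrightarrow> (\<forall>a<m. (\<Sum>i<n. \<phi> i $ a) = 0)"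
  unfolding centered_def mat_kernel_def
  by (auto simp: vec_eq_iff ones_vec_def scalar_prod_def atLeast0LessThan)

lemma gram_row_sum:
  assumes "i < n"
  shows "(\<Sum>j<n. gram m n \<phi> $$ (i, j)) = (\<Sum>a<m. \<phi> i $ a * (\<Sum>j<n. \<phi> j $ a))"
proof -
  have "(\<Sum>j<n. gram m n \<phi> $$ (i, j)) = (\<Sum>j<n. \<Sum>a<m. \<phi> i $ a * \<phi> j $ a)"
    using assms by (simp add: gram_index)
  also have "\<dots> = (\<Sum>a<m. \<Sum>j<n. \<phi> i $ a * \<phi> j $ a)" by (rule sum.swap)
  finally show ?thesis by (simp add: sum_distrib_left)
qed

text \<open>The quadratic form of G at the all-ones vector is the squared norm of F1, so G1 = 0
  already forces F1 = 0.\<close>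

lemma centered_iff_gram:
  "centered m n \<phi> \<longleftrightarrow> (\<forall>i<n. (\<Sum>j<n. gram m n \<phi> $$ (i, j)) = 0)"
proof
  assume "centered m n \<phi>"
  then show "\<forall>i<n. (\<Sum>j<n. gram m n \<phi> $$ (i, j)) = 0"
    by (simp add: centered_iff gram_row_sum)
next
  assume *: "\<forall>i<n. (\<Sum>j<n. gram m n \<phi> $$ (i, j)) = 0"
  have "(\<Sum>a<m. (\<Sum>i<n. \<phi> i $ a) * (\<Sum>j<n. \<phi> j $ a))
      = (\<Sum>a<m. \<Sum>i<n. \<phi> i $ a * (\<Sum>j<n. \<phi> j $ a))"
    by (simp add: sum_distrib_right)
  also have "\<dots> = (\<Sum>i<n. \<Sum>a<m. \<phi> i $ a * (\<Sum>j<n. \<phi> j $ a))"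
    by (rule sum.swap)
  also have "\<dots> = 0"
    using * by (simp add: gram_row_sum[symmetric])
  finally show "centered m n \<phi>" by (simp only: sum_of_squares_eq_0 centered_iff)
qed

lemma axial_iff:
  "axial m n \<phi> \<longleftrightarrow> (\<exists>x\<in>carrier_vec m. \<forall>i<n. (\<Sum>a<m. \<phi> i $ a * x $ a) = 1)"
proof -
  have *: "col (synthesis m n \<phi>) i \<bullet> x = (\<Sum>a<m. \<phi> i $ a * x $ a)"
    if "i < n" "x \<in> carrier_vec m" for i x
    using that by (simp add: scalar_prod_def atLeast0LessThan)
  have "axial m n \<phi> \<longleftrightarrow>
      (\<exists>x\<in>carrier_vec m. transpose_mat (synthesis m n \<phi>) *\<^sub>v x = ones_vec n)"
    unfolding axial_def
    by (subst vec_space.col_space_eq[of _ n m]) (auto simp: ones_vec_def)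
  then show ?thesis
    by (auto simp: vec_eq_iff ones_vec_def *)
qed

text \<open>If F^T x = 1, then F1 = F F^T x = \<alpha> x and hence G1 = \<alpha> 1. Conversely, G1 =
  \<alpha> 1 makes x = F1 / \<alpha> a preimage of the all-ones vector.\<close>

lemma axial_iff_gram:
  assumes t: "tight_with_bound m n \<phi> \<alpha>" and "0 < \<alpha>"
  shows "axial m n \<phi> \<longleftrightarrow> (\<forall>i<n. (\<Sum>j<n. gram m n \<phi> $$ (i, j)) = \<alpha>)"
proof
  assume "axial m n \<phi>"
  then obtain x where x: "\<And>i. i < n \<Longrightarrow> (\<Sum>a<m. \<phi> i $ a * x $ a) = 1"
    by (auto simp: axial_iff)
  have "(\<Sum>j<n. \<phi> j $ a) = \<alpha> * x $ a" if a: "a < m" for a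
  proof -
    have "(\<Sum>j<n. \<phi> j $ a) = (\<Sum>j<n. \<Sum>b<m. \<phi> j $ a * (\<phi> j $ b * x $ b))"
      using x by (simp add: sum_distrib_left[symmetric])
    also have "\<dots> = (\<Sum>b<m. (\<Sum>j<n. \<phi> j $ a * \<phi> j $ b) * x $ b)"
      by (subst sum.swap) (simp add: sum_distrib_right mult.assoc)
    also have "\<dots> = (\<Sum>b<m. if a = b then \<alpha> * x $ b else 0)"
      using t a by (intro sum.cong refl) (simp add: tight_with_bound_iff)
    finally show ?thesis using a by simp
  qed
  then have "(\<Sum>j<n. gram m n \<phi> $$ (i, j)) = \<alpha> * (\<Sum>a<m. \<phi> i $ a * x $ a)" if "i < n" for i
    using that by (simp add: gram_row_sum sum_distrib_left mult.left_commute)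
  then show "\<forall>i<n. (\<Sum>j<n. gram m n \<phi> $$ (i, j)) = \<alpha>" using x by simp
next
  assume *: "\<forall>i<n. (\<Sum>j<n. gram m n \<phi> $$ (i, j)) = \<alpha>"
  let ?x = "vec m (\<lambda>a. (\<Sum>j<n. \<phi> j $ a) / \<alpha>)"
  have "(\<Sum>a<m. \<phi> i $ a * ?x $ a) = 1" if "i < n" for i
  proof -
    have "(\<Sum>a<m. \<phi> i $ a * ?x $ a) = (\<Sum>a<m. \<phi> i $ a * (\<Sum>j<n. \<phi> j $ a)) / \<alpha>"
      by (simp add: sum_divide_distrib[of _ "{..<m}"])
    then show ?thesis using * that assms(2) by (simp add: gram_row_sum[symmetric])
  qed
  then show "axial m n \<phi>" unfolding axial_iff by (intro bexI[of _ ?x]) auto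
qed

section \<open>Orthonormal bases for ranges of projections; frames from Gram matrices\<close>

text \<open>
  The induction is on the trace: splitting off a normalised nonzero column of \<open>P\<close> lowers it by 1.
\<close>

lemma symmetric_idempotent_decomposition_aux:
  fixes P :: "nat \<Rightarrow> nat \<Rightarrow> real"
  assumes "\<And>i j. i < n \<Longrightarrow> j < n \<Longrightarrow> P i j = P j i"
    and "\<And>i j. i < n \<Longrightarrow> j < n \<Longrightarrow> (\<Sum>t<n. P i t * P t j) = P i j"
    and "(\<Sum>i<n. P i i) \<le> real N"
  shows "\<exists>m q. (\<forall>a<m. \<forall>b<m. (\<Sum>i<n. q a i * q b i) = (if a = b then 1 else 0)) \<and>
    (\<forall>i<n. \<forall>j<n. P i j = (\<Sum>a<m::nat. q a i * q a j))"
  using assms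
proof (induction N arbitrary: P)
  case (0 P)
  \<comment> \<open>Each diagonal entry is the squared norm of a column, so a trace of at most 0
    makes P vanish and the empty family (m = 0) serves.\<close>
  have sq: "P i i = (\<Sum>t<n. P t i * P t i)" if "i < n" for i
  proof -
    have "P i i = (\<Sum>t<n. P i t * P t i)" using 0(2) that by simp
    also have "\<dots> = (\<Sum>t<n. P t i * P t i)"
      using 0(1) that by (intro sum.cong refl) (metis lessThan_iff)
    finally show ?thesis .
  qed
  have nn: "0 \<le> P i i" if "i < n" for i using sq[OF that] by (simp add: sum_nonneg)
  then have "0 \<le> (\<Sum>i<n. P i i)" by (intro sum_nonneg) simp
  then have "(\<Sum>i<n. P i i) = 0" using 0(3) by simp
  then have "\<forall>i<n. P i i = 0" using nn by (subst (asm) sum_nonneg_eq_0_iff) auto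
  then have "P t i = 0" if "i < n" "t < n" for i t
    using sq[OF that(1)] sum_of_squares_eq_0[of "\<lambda>t. P t i" n] that by simp
  then show ?case by (intro exI[of _ 0]) auto
next
  case (Suc N P)
  note sym = Suc.prems(1) and idem = Suc.prems(2)
  show ?case
  proof (cases "\<forall>i<n. \<forall>t<n. P t i = 0")
    case True
    then show ?thesis by (intro exI[of _ 0]) auto
  next
    case False
    then obtain p s where p: "p < n" "s < n" "P s p \<noteq> 0" by auto
    have sq: "P p p = (\<Sum>t<n. P t p * P t p)"
    proof -
      have "P p p = (\<Sum>t<n. P p t * P t p)" using idem p by simp
      also have "\<dots> = (\<Sum>t<n. P t p * P t p)"
        using sym p by (intro sum.cong refl) (metis lessThan_iff)
      finally show ?thesis .
    qed
    have "P p p \<noteq> 0" using sq sum_of_squares_eq_0[of "\<lambda>t. P t p" n] p by metis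
    moreover have "P p p \<ge> 0" using sq by (simp add: sum_nonneg)
    ultimately have pos: "P p p > 0" by simp
    \<comment> \<open>Column p has squared norm \<open>P p p\<close>, so u is a unit vector in the
      range of P, fixed by P.\<close>
    define u where "u t = P t p / sqrt (P p p)" for t
    have uu: "(\<Sum>t<n. u t * u t) = 1"
    proof -
      have "(\<Sum>t<n. u t * u t) = (\<Sum>t<n. P t p * P t p) / P p p"
        using pos by (simp add: u_def sum_divide_distrib)
      then show ?thesis using sq pos by simp
    qed
    have Pu: "(\<Sum>t<n. P i t * u t) = u i" if "i < n" for i
    proof -
      have "(\<Sum>t<n. P i t * u t) = (\<Sum>t<n. P i t * P t p) / sqrt (P p p)"
        by (simp add: u_def sum_divide_distrib)
      then show ?thesis using idem p that by (simp add: u_def)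
    qed
    have uP: "(\<Sum>t<n. u t * P t i) = u i" if "i < n" for i
    proof -
      have "(\<Sum>t<n. u t * P t i) = (\<Sum>t<n. P i t * u t)"
        using sym that by (intro sum.cong refl) (simp add: mult.commute)
      then show ?thesis using Pu that by simp
    qed
    define P' where "P' i j = P i j - u i * u j" for i j
    have sym': "P' i j = P' j i" if "i < n" "j < n" for i j
      using sym that by (simp add: P'_def)
    have P'u: "(\<Sum>t<n. P' i t * u t) = 0" if "i < n" for i
      using Pu[OF that] uu
      by (simp add: P'_def left_diff_distrib sum_subtractf mult.assoc flip: sum_distrib_left)
    have idem': "(\<Sum>t<n. P' i t * P' t j) = P' i j" if "i < n" "j < n" for i j
    proof -
      have "(\<Sum>t<n. P' i t * P' t j) = (\<Sum>t<n. P' i t * P t j - P' i t * u t * u j)"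
        by (intro sum.cong refl) (simp add: P'_def[of _ j] algebra_simps)
      also have "\<dots> = (\<Sum>t<n. P' i t * P t j)"
        using P'u that by (simp add: sum_subtractf flip: sum_distrib_right)
      also have "\<dots> = (\<Sum>t<n. P i t * P t j) - u i * (\<Sum>t<n. u t * P t j)"
        by (simp add: P'_def left_diff_distrib sum_subtractf sum_distrib_left mult.assoc)
      also have "\<dots> = P' i j" using idem uP that by (simp add: P'_def)
      finally show ?thesis .
    qed
    have tr': "(\<Sum>i<n. P' i i) \<le> real N"
      using Suc.prems(3) uu by (simp add: P'_def sum_subtractf)
    obtain m q where orth: "\<And>a b. a < m \<Longrightarrow> b < m \<Longrightarrow>
          (\<Sum>i<n. q a i * q b i) = (if a = b then 1 else 0)"
      and dec: "\<And>i j. i < n \<Longrightarrow> j < n \<Longrightarrow> P' i j = (\<Sum>a<m::nat. q a i * q a j)"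
      using Suc.IH[of P', OF sym' idem' tr'] by blast
    \<comment> \<open>The new vector is orthogonal to the inductively obtained ones: the sum of its
      squared inner products with them is the quadratic form of \<open>P'\<close> at u, and
      \<open>P'\<close> annihilates u.\<close>
    have "(\<Sum>a<m. (\<Sum>i<n. q a i * u i) * (\<Sum>i<n. q a i * u i)) = 0"
    proof -
      have "(\<Sum>a<m. (\<Sum>i<n. q a i * u i) * (\<Sum>i<n. q a i * u i))
          = (\<Sum>a<m. \<Sum>i<n. u i * (\<Sum>j<n. q a i * q a j * u j))"
        by (simp add: sum_product sum_distrib_left mult_ac)
      also have "\<dots> = (\<Sum>i<n. u i * (\<Sum>a<m. \<Sum>j<n. q a i * q a j * u j))"
        by (subst sum.swap) (simp add: sum_distrib_left)
      also have "\<dots> = (\<Sum>i<n. u i * (\<Sum>j<n. (\<Sum>a<m. q a i * q a j) * u j))"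
        by (simp only: sum_distrib_right sum.swap[where A = "{..<m}" and B = "{..<n}"])
      also have "\<dots> = (\<Sum>i<n. u i * (\<Sum>j<n. P' i j * u j))"
        by (simp add: dec)
      also have "\<dots> = 0" using P'u by simp
      finally show ?thesis .
    qed
    then have qu: "(\<Sum>i<n. q a i * u i) = 0" if "a < m" for a
      using that by (simp only: sum_of_squares_eq_0)
    then have uq: "(\<Sum>i<n. u i * q a i) = 0" if "a < m" for a
      using that by (simp add: mult.commute)
    show ?thesis
    proof (intro exI[of _ "Suc m"] exI[of _ "q(m := u)"] conjI allI impI)
      fix a b assume "a < Suc m" "b < Suc m"
      then show "(\<Sum>i<n. (q(m := u)) a i * (q(m := u)) b i) = (if a = b then 1 else 0)"
        using orth qu uq uu by (auto simp: less_Suc_eq)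
    next
      fix i j assume ij: "i < n" "j < n"
      have "(\<Sum>a<m. (q(m := u)) a i * (q(m := u)) a j) = (\<Sum>a<m. q a i * q a j)"
        by (intro sum.cong) auto
      then show "P i j = (\<Sum>a<Suc m. (q(m := u)) a i * (q(m := u)) a j)"
        using dec[OF ij] by (simp add: P'_def)
    qed
  qed
qed

text \<open>The ceiling of the trace is an admissible starting bound for the induction.\<close>

lemma symmetric_idempotent_decomposition:
  fixes P :: "nat \<Rightarrow> nat \<Rightarrow> real"
  assumes "\<And>i j. i < n \<Longrightarrow> j < n \<Longrightarrow> P i j = P j i"
    and "\<And>i j. i < n \<Longrightarrow> j < n \<Longrightarrow> (\<Sum>t<n. P i t * P t j) = P i j"
  obtains m :: nat and q
  where "\<And>a b. a < m \<Longrightarrow> b < m \<Longrightarrow> (\<Sum>i<n. q a i * q b i) = (if a = b then 1 else 0)"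
    and "\<And>i j. i < n \<Longrightarrow> j < n \<Longrightarrow> P i j = (\<Sum>a<m. q a i * q a j)"
  using symmetric_idempotent_decomposition_aux[of n P, OF assms real_nat_ceiling_ge] by blast

text \<open>P = G / \<alpha> is an orthogonal projection. With an orthonormal basis of its range as
  the rows of q, the columns of q scaled by \<open>sqrt \<alpha>\<close> are the frame vectors: the
  decomposition of P gives the Gram matrix and orthonormality gives tightness.\<close>

lemma etf_of_gram:
  assumes G: "G \<in> carrier_mat n n"
    and sym: "\<And>i j. i < n \<Longrightarrow> j < n \<Longrightarrow> G $$ (i, j) = G $$ (j, i)"
    and diag: "\<And>i. i < n \<Longrightarrow> G $$ (i, i) = 1"
    and equi: "\<And>i j. i < n \<Longrightarrow> j < n \<Longrightarrow> i \<noteq> j \<Longrightarrow> \<bar>G $$ (i, j)\<bar> = c"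
    and sq: "\<And>i j. i < n \<Longrightarrow> j < n \<Longrightarrow> (\<Sum>t<n. G $$ (i, t) * G $$ (t, j)) = \<alpha> * G $$ (i, j)"
    and \<alpha>: "0 < \<alpha>"
  obtains m \<phi> where "etf m n \<phi>" "gram m n \<phi> = G"
proof -
  define P where "P i j = G $$ (i, j) / \<alpha>" for i j
  have symP: "P i j = P j i" if "i < n" "j < n" for i j using sym that by (simp add: P_def)
  have idemP: "(\<Sum>t<n. P i t * P t j) = P i j" if "i < n" "j < n" for i j
  proof -
    have "(\<Sum>t<n. P i t * P t j) = (\<Sum>t<n. G $$ (i, t) * G $$ (t, j)) / \<alpha>\<^sup>2"
      by (simp add: P_def sum_divide_distrib power2_eq_square)
    then show ?thesis using sq[OF that] \<alpha> by (simp add: P_def power2_eq_square)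
  qed
  obtain m q
    where orth: "\<And>a b. a < m \<Longrightarrow> b < m \<Longrightarrow> (\<Sum>i<n. q a i * q b i) = (if a = b then 1 else 0)"
    and dec: "\<And>i j. i < n \<Longrightarrow> j < n \<Longrightarrow> P i j = (\<Sum>a<m::nat. q a i * q a j)"
    using symmetric_idempotent_decomposition[of n P, OF symP idemP] by blast
  have sqrt: "(sqrt \<alpha> * x) * (sqrt \<alpha> * y) = \<alpha> * (x * y)" for x y
    using \<alpha> by (simp add: mult.assoc mult.left_commute[of x] flip: mult.assoc[of "sqrt \<alpha>" "sqrt \<alpha>"])
  define \<phi> where "\<phi> i = vec m (\<lambda>a. sqrt \<alpha> * q a i)" for i
  have gr: "gram m n \<phi> $$ (i, j) = G $$ (i, j)" if "i < n" "j < n" for i j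
  proof -
    have "gram m n \<phi> $$ (i, j) = \<alpha> * (\<Sum>a<m. q a i * q a j)"
      using that by (simp add: gram_index \<phi>_def sum_distrib_left sqrt)
    then show ?thesis using dec[OF that, symmetric] \<alpha> by (simp add: P_def)
  qed
  have "(\<Sum>i<n. \<phi> i $ a * \<phi> i $ b) = (if a = b then \<alpha> else 0)" if "a < m" "b < m" for a b
  proof -
    have "(\<Sum>i<n. \<phi> i $ a * \<phi> i $ b) = \<alpha> * (\<Sum>i<n. q a i * q b i)"
      using that by (simp add: \<phi>_def sum_distrib_left sqrt)
    then show ?thesis using orth that by simp
  qed
  then have "tight_with_bound m n \<phi> \<alpha>" by (simp add: tight_with_bound_iff)
  moreover have "\<phi> i \<in> carrier_vec m" for i by (simp add: \<phi>_def)
  ultimately have "etf m n \<phi>" using \<alpha> diag equi by (auto simp: etf_iff gr)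
  moreover have "gram m n \<phi> = G" using G gr by (intro eq_matI) auto
  ultimately show ?thesis using that by blast
qed

subsection \<open>From strongly regular graphs to equiangular tight frames\<close>

lemma adj_mat_carrier [simp]:
  "adj_mat v E \<in> carrier_mat v v" "dim_row (adj_mat v E) = v" "dim_col (adj_mat v E) = v"
  by (simp_all add: adj_mat_def)

lemma adj_mat_index:
  "i < v \<Longrightarrow> j < v \<Longrightarrow> adj_mat v E $$ (i, j) = (if {i, j} \<in> E then 1 else 0)"
  by (simp add: adj_mat_def)

lemma adj_mat_row_sum:
  assumes "i < v"
  shows "(\<Sum>j<v. adj_mat v E $$ (i, j)) = real (card {j. j < v \<and> {i, j} \<in> E})"
proof -
  have "(\<Sum>j<v. adj_mat v E $$ (i, j)) = (\<Sum>j<v. if {i, j} \<in> E then 1 else 0)"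
    using assms by (simp add: adj_mat_index)
  also have "\<dots> = (\<Sum>j\<in>{j\<in>{..<v}. {i, j} \<in> E}. 1)"
    by (rule sum.inter_filter[symmetric]) simp
  also have "\<dots> = real (card {j. j < v \<and> {i, j} \<in> E})"
    by simp
  finally show ?thesis .
qed

lemma adj_mat_square:
  assumes "i < v" "j < v"
  shows "(adj_mat v E * adj_mat v E) $$ (i, j)
    = real (card {t. t < v \<and> {i, t} \<in> E \<and> {t, j} \<in> E})"
proof -
  have "(adj_mat v E * adj_mat v E) $$ (i, j) = (\<Sum>t<v. adj_mat v E $$ (i, t) * adj_mat v E $$ (t, j))"
    using assms by (simp add: scalar_prod_def atLeast0LessThan)
  also have "\<dots> = (\<Sum>t<v. if {i, t} \<in> E \<and> {t, j} \<in> E then 1 else 0)"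
    using assms by (intro sum.cong refl) (simp add: adj_mat_index)
  also have "\<dots> = (\<Sum>t\<in>{t\<in>{..<v}. {i, t} \<in> E \<and> {t, j} \<in> E}. 1)"
    by (rule sum.inter_filter[symmetric]) simp
  also have "\<dots> = real (card {t. t < v \<and> {i, t} \<in> E \<and> {t, j} \<in> E})"
    by simp
  finally show ?thesis .
qed

section \<open>The matrix S of a strongly regular graph and its square\<close>

locale srg_entries =
  fixes v k l \<mu> :: nat and A :: "real mat"
  assumes adjacency: "srg_adjacency v k l \<mu> A" and k_pos: "0 < k" and k_less: "k < v - 1"
begin

abbreviation "a \<equiv> \<lambda>i j. A $$ (i, j)"

text \<open>
  \<open>s\<close> is \<open>2A + I - J\<close>, the negative of the Seidel matrix, so that \<open>G = I + \<beta>S\<close>;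
  by regularity \<open>-r\<close> is its eigenvalue on the all-ones vector.
\<close>

definition s :: "nat \<Rightarrow> nat \<Rightarrow> real" where
  "s i j = 2 * a i j + (if i = j then 1 else 0) - 1"

definition r :: real where
  "r = real v - 2 * real k - 1"

lemma v_gt: "2 < v"
  using k_pos k_less by simp

lemma A_carrier [simp]: "A \<in> carrier_mat v v" "dim_row A = v" "dim_col A = v"
  using adjacency by (auto simp: srg_adjacency_def)

lemma a_01: "i < v \<Longrightarrow> j < v \<Longrightarrow> a i j = 0 \<or> a i j = 1"
  using adjacency by (auto simp: srg_adjacency_def adj_mat_index)

lemma a_diag: "i < v \<Longrightarrow> a i i = 0"
  using adjacency by (force simp: srg_adjacency_def srg_def simple_graph_def adj_mat_index)

lemma a_sym: "i < v \<Longrightarrow> j < v \<Longrightarrow> a i j = a j i"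
  using adjacency by (auto simp: srg_adjacency_def adj_mat_index insert_commute)

lemma a_row_sum: "i < v \<Longrightarrow> (\<Sum>j<v. a i j) = real k"
  using adjacency by (auto simp: srg_adjacency_def srg_def regular_graph_def adj_mat_row_sum)

lemma a_col_sum: "i < v \<Longrightarrow> (\<Sum>j<v. a j i) = real k"
  using a_row_sum[of i] a_sym[of i] by simp

lemma a_square:
  assumes "i < v" "j < v"
  shows "(\<Sum>t<v. a i t * a t j)
    = (real l - real \<mu>) * a i j + (real k - real \<mu>) * (if i = j then 1 else 0) + real \<mu>"
proof -
  have "A * A = (real l - real \<mu>) \<cdot>\<^sub>m A + (real k - real \<mu>) \<cdot>\<^sub>m 1\<^sub>m v + real \<mu> \<cdot>\<^sub>m J_mat v"
    using adjacency by (auto simp: srg_adjacency_def srg_def)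
  then have "(A * A) $$ (i, j)
      = ((real l - real \<mu>) \<cdot>\<^sub>m A + (real k - real \<mu>) \<cdot>\<^sub>m 1\<^sub>m v + real \<mu> \<cdot>\<^sub>m J_mat v) $$ (i, j)"
    by simp
  then show ?thesis
    using assms by (simp add: scalar_prod_def atLeast0LessThan J_mat_def)
qed

text \<open>Since k > 0, vertex 0 has a neighbour. Edges and nonedges are where off-diagonal matrix
  identities become scalar equations.\<close>

lemma edge_exists:
  obtains i j where "i < v" "j < v" "i \<noteq> j" "a i j = 1"
proof -
  have "\<exists>j<v. a 0 j \<noteq> 0"
    using a_row_sum[of 0] k_pos v_gt by (metis lessThan_iff less_trans of_nat_0_less_iff
      order_less_irrefl sum.neutral zero_less_numeral)
  then show ?thesis using that[of 0] a_01[of 0] a_diag[of 0] v_gt by fastforce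
qed

lemma nonedge_exists:
  obtains i j where "i < v" "j < v" "i \<noteq> j" "a i j = 0"
proof -
  have "\<exists>j<v. j \<noteq> 0 \<and> a 0 j \<noteq> 1"
  proof (rule ccontr)
    assume *: "\<not> ?thesis"
    have "real k = a 0 0 + (\<Sum>j\<in>{..<v} - {0}. a 0 j)"
      using a_row_sum[of 0] v_gt by (subst sum.remove[symmetric]) auto
    also have "(\<Sum>j\<in>{..<v} - {0}. a 0 j) = (\<Sum>j\<in>{..<v} - {0}. 1)"
      using * by (intro sum.cong) auto
    finally have "real k = real (v - 1)" using a_diag[of 0] v_gt by simp
    then show False using k_less by simp
  qed
  then show ?thesis using that[of 0] a_01[of 0] v_gt by fastforce
qed

lemma s_diag: "i < v \<Longrightarrow> s i i = 0"
  by (simp add: s_def a_diag)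

lemma s_sym: "i < v \<Longrightarrow> j < v \<Longrightarrow> s i j = s j i"
  by (simp add: s_def a_sym)

lemma abs_s: "i < v \<Longrightarrow> j < v \<Longrightarrow> i \<noteq> j \<Longrightarrow> \<bar>s i j\<bar> = 1"
  using a_01[of i j] by (auto simp: s_def)

lemma s_row_sum:
  assumes "i < v"
  shows "(\<Sum>j<v. s i j) = - r"
  using assms a_row_sum[OF assms]
  by (simp add: s_def r_def sum.distrib sum_subtractf flip: sum_distrib_left)

text \<open>Expansion of \<open>(2A + I - J)\<^sup>2\<close>, where AJ = JA = kJ by regularity and
  the square of A comes from the strongly regular equation.\<close>

lemma s_square:
  assumes i: "i < v" and j: "j < v"
  shows "(\<Sum>t<v. s i t * s t j) = 4 * (real l - real \<mu> + 1) * a i j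
    + (4 * (real k - real \<mu>) + 1) * (if i = j then 1 else 0)
    + (4 * real \<mu> + real v - 2 - 4 * real k)"
proof -
  let ?d = "\<lambda>i j. if i = j then 1 else (0::real)"
  have "(\<Sum>t<v. s i t * s t j)
      = (\<Sum>t<v. 4 * (a i t * a t j) + (if t = j then 2 * a i t else 0) - 2 * a i t
          + (if i = t then 2 * a t j else 0) + (if i = t then ?d t j else 0) - (if i = t then 1 else 0)
          - 2 * a t j - (if t = j then 1 else 0) + 1)"
    by (intro sum.cong refl) (simp add: s_def algebra_simps)
  also have "\<dots> = 4 * (\<Sum>t<v. a i t * a t j) + 2 * a i j - 2 * (\<Sum>t<v. a i t) + 2 * a i j + ?d i j
      - 1 - 2 * (\<Sum>t<v. a t j) - 1 + real v"
    using i j by (simp add: sum.distrib sum_subtractf sum_distrib_left)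
  finally show ?thesis
    using a_square[OF i j] a_row_sum[OF i] a_col_sum[OF j] by (simp add: algebra_simps)
qed

section \<open>The candidate Gram matrix and the parameter condition\<close>

lemma srg_gram_carrier [simp]: "srg_gram v \<beta> A \<in> carrier_mat v v"
  by (auto simp: srg_gram_def J_mat_def)

lemma srg_gram_index:
  "i < v \<Longrightarrow> j < v \<Longrightarrow> srg_gram v \<beta> A $$ (i, j) = (if i = j then 1 else 0) + \<beta> * s i j"
  by (simp add: srg_gram_def J_mat_def s_def algebra_simps)

lemma srg_gram_square:
  assumes i: "i < v" and j: "j < v"
  shows "(\<Sum>t<v. srg_gram v \<beta> A $$ (i, t) * srg_gram v \<beta> A $$ (t, j))
    = (if i = j then 1 else 0) + 2 * \<beta> * s i j + \<beta>\<^sup>2 * (\<Sum>t<v. s i t * s t j)"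
proof -
  have "(\<Sum>t<v. srg_gram v \<beta> A $$ (i, t) * srg_gram v \<beta> A $$ (t, j))
      = (\<Sum>t<v. (if i = t then if t = j then 1 else 0 else 0) + (if i = t then \<beta> * s t j else 0)
         + (if t = j then \<beta> * s i t else 0) + \<beta>\<^sup>2 * (s i t * s t j))"
    using i j by (intro sum.cong refl) (simp add: srg_gram_index algebra_simps power2_eq_square)
  also have "\<dots> = (if i = j then 1 else 0) + 2 * \<beta> * s i j + \<beta>\<^sup>2 * (\<Sum>t<v. s i t * s t j)"
    using i j by (simp add: sum.distrib sum_distrib_left)
  finally show ?thesis .
qed

lemma srg_gram_row_sum:
  "i < v \<Longrightarrow> (\<Sum>j<v. srg_gram v \<beta> A $$ (i, j)) = 1 - \<beta> * r"
  using s_row_sum[of i] by (simp add: srg_gram_index sum.distrib flip: sum_distrib_left)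

text \<open>S is +1 at an edge and -1 at a nonedge, so adding the two entry equations cancels
  \<alpha> and the linear term in \<beta>. What remains is \<open>\<beta>\<^sup>2\<close> times the
  parameter relation.\<close>

lemma parameter_condition:
  assumes "\<beta> \<noteq> 0"
    and sq: "\<And>i j. i < v \<Longrightarrow> j < v \<Longrightarrow>
      (\<Sum>t<v. srg_gram v \<beta> A $$ (i, t) * srg_gram v \<beta> A $$ (t, j)) = \<alpha> * srg_gram v \<beta> A $$ (i, j)"
  shows "int v = 4 * int k - 2 * int l - 2 * int \<mu>"
proof -
  obtain i j where e: "i < v" "j < v" "i \<noteq> j" "a i j = 1" by (rule edge_exists)
  obtain i' j' where n: "i' < v" "j' < v" "i' \<noteq> j'" "a i' j' = 0" by (rule nonedge_exists)
  have 1: "2 * \<beta> + \<beta>\<^sup>2 * (4 * real l + 2 + real v - 4 * real k) = \<alpha> * \<beta>"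
    using sq[OF e(1,2)] e(3,4)
    unfolding srg_gram_square[OF e(1,2)] s_square[OF e(1,2)] srg_gram_index[OF e(1,2)]
    by (simp add: s_def algebra_simps)
  have 2: "- 2 * \<beta> + \<beta>\<^sup>2 * (4 * real \<mu> + real v - 2 - 4 * real k) = - (\<alpha> * \<beta>)"
    using sq[OF n(1,2)] n(3,4)
    unfolding srg_gram_square[OF n(1,2)] s_square[OF n(1,2)] srg_gram_index[OF n(1,2)]
    by (simp add: s_def algebra_simps)
  have "\<beta>\<^sup>2 * (2 * (2 * real l + 2 * real \<mu> + real v - 4 * real k)) = 0"
    using 1 2 by (simp add: algebra_simps)
  then have "2 * real l + 2 * real \<mu> + real v - 4 * real k = 0" using assms(1) by simp
  then show ?thesis by linarith
qed

section \<open>Spectrum of S and the choice of \<beta> under the parameter condition\<close>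

context
  assumes cond: "int v = 4 * int k - 2 * int l - 2 * int \<mu>"
begin

lemma real_cond: "real v = 4 * real k - 2 * real l - 2 * real \<mu>"
  using cond by linarith

text \<open>The parameter condition is exactly what lets the J term of \<open>s_square\<close> be
  absorbed into a multiple of S = 2A + I - J.\<close>

lemma s_square':
  assumes "i < v" "j < v"
  shows "(\<Sum>t<v. s i t * s t j)
    = 2 * (real l - real \<mu> + 1) * s i j + (real v - 1) * (if i = j then 1 else 0)"
  unfolding s_square[OF assms] real_cond by (simp add: s_def algebra_simps)

text \<open>The quadratic equation of S applied to its eigenvector 1 with eigenvalue -r; the proof
  sums row 0 of the square of S in two ways.\<close>

lemma r_square: "r\<^sup>2 = real v - 1 - 2 * (real l - real \<mu> + 1) * r"
proof -
  have 0: "0 < v" using v_gt by simp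
  have "(\<Sum>j<v. \<Sum>t<v. s 0 t * s t j) = (\<Sum>t<v. \<Sum>j<v. s 0 t * s t j)"
    by (rule sum.swap)
  also have "\<dots> = (\<Sum>t<v. s 0 t * (- r))"
    by (intro sum.cong refl) (simp only: s_row_sum lessThan_iff flip: sum_distrib_left)
  also have "\<dots> = r\<^sup>2"
    unfolding sum_distrib_right[symmetric] s_row_sum[OF 0] by (simp add: power2_eq_square)
  finally show ?thesis
    using s_row_sum[OF 0] 0
    by (simp add: s_square' sum.distrib flip: sum_distrib_left)
qed

lemma r_nonzero: "r \<noteq> 0"
  using r_square v_gt by auto

text \<open>The coefficient is the sum of the eigenvalues -r and (v - 1) / r; writing it this way
  eliminates l and \<mu>.\<close>

lemma s_square_coeff: "2 * (real l - real \<mu> + 1) = ((real v - 1) - r\<^sup>2) / r"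
  using r_square r_nonzero by (simp add: field_simps)

text \<open>G G and G are both combinations of I and S. The diagonal fixes \<alpha>; the coefficient
  of S gives an equation for \<beta> whose last two factors vanish exactly when 1 + \<beta>(v - 1)/r
  or 1 - \<beta>r, an eigenvalue of G, is zero.\<close>

lemma srg_gram_square_iff:
  "(\<forall>i<v. \<forall>j<v. (\<Sum>t<v. srg_gram v \<beta> A $$ (i, t) * srg_gram v \<beta> A $$ (t, j))
      = \<alpha> * srg_gram v \<beta> A $$ (i, j)) \<longleftrightarrow>
   \<alpha> = 1 + \<beta>\<^sup>2 * (real v - 1) \<and> \<beta> * ((\<beta> * (real v - 1) + r) * (\<beta> * r - 1)) = 0"
  (is "?L \<longleftrightarrow> ?D \<and> ?O")
proof -
  let ?c = "2 * (real l - real \<mu> + 1)"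
  have O: "?O \<longleftrightarrow> 2 * \<beta> + \<beta>\<^sup>2 * ?c = (1 + \<beta>\<^sup>2 * (real v - 1)) * \<beta>"
  proof -
    \<comment> \<open>Multiplying by r clears the denominator of the coefficient, and the resulting
      polynomial factors.\<close>
    have "r * (2 * \<beta> + \<beta>\<^sup>2 * ?c - (1 + \<beta>\<^sup>2 * (real v - 1)) * \<beta>)
        = - (\<beta> * ((\<beta> * (real v - 1) + r) * (\<beta> * r - 1)))"
      using r_nonzero unfolding s_square_coeff
      by (simp add: field_simps power2_eq_square)
    then show ?thesis using r_nonzero
      by (metis add.inverse_neutral eq_iff_diff_eq_0 mult_eq_0_iff neg_equal_0_iff_equal)
  qed
  have sq: "(\<Sum>t<v. srg_gram v \<beta> A $$ (i, t) * srg_gram v \<beta> A $$ (t, j))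
      = (if i = j then 1 + \<beta>\<^sup>2 * (real v - 1) else (2 * \<beta> + \<beta>\<^sup>2 * ?c) * s i j)"
    if "i < v" "j < v" for i j
    unfolding srg_gram_square[OF that] s_square'[OF that]
    using that by (simp add: s_diag algebra_simps)
  show ?thesis
  proof
    assume L: ?L
    have L': "(if i = j then 1 + \<beta>\<^sup>2 * (real v - 1) else (2 * \<beta> + \<beta>\<^sup>2 * ?c) * s i j)
        = \<alpha> * ((if i = j then 1 else 0) + \<beta> * s i j)" if "i < v" "j < v" for i j
      using L[rule_format, OF that] unfolding sq[OF that] srg_gram_index[OF that] .
    have D: ?D using L'[of 0 0] v_gt by (simp add: s_diag)
    obtain i j where e: "i < v" "j < v" "i \<noteq> j" "a i j = 1" by (rule edge_exists)
    have "s i j = 1" using e by (simp add: s_def)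
    then have ?O unfolding O using L'[of i j] e D by simp
    then show "?D \<and> ?O" using D by blast
  next
    assume *: "?D \<and> ?O"
    then have off: "2 * \<beta> + \<beta>\<^sup>2 * ?c = \<alpha> * \<beta>" using O by simp
    show ?L
    proof (intro allI impI)
      fix i j assume ij: "i < v" "j < v"
      show "(\<Sum>t<v. srg_gram v \<beta> A $$ (i, t) * srg_gram v \<beta> A $$ (t, j)) = \<alpha> * srg_gram v \<beta> A $$ (i, j)"
        unfolding sq[OF ij] srg_gram_index[OF ij] off using * ij by (simp add: s_diag)
    qed
  qed
qed

text \<open>
  The eigenvalues of \<open>S\<close> are \<open>-r\<close> and \<open>(v - 1) / r\<close>; \<open>\<beta>\<^sub>s\<close> is the value of
  \<open>\<beta>\<close> sending the negative one to the eigenvalue 0 of \<open>G\<close>.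
\<close>

definition \<beta>\<^sub>s :: real where
  "\<beta>\<^sub>s = (if r > 0 then 1 / r else - r / (real v - 1))"

lemma \<beta>_pos: "\<beta>\<^sub>s > 0"
  using r_nonzero v_gt by (auto simp: \<beta>\<^sub>s_def divide_less_0_iff)

text \<open>For positive \<beta> the sign of r leaves only one factor that can vanish: the second if
  r > 0, the first if r < 0.\<close>

lemma srg_gram_square_pos_iff:
  assumes "\<beta> > 0"
  shows "(\<forall>i<v. \<forall>j<v. (\<Sum>t<v. srg_gram v \<beta> A $$ (i, t) * srg_gram v \<beta> A $$ (t, j))
      = \<alpha> * srg_gram v \<beta> A $$ (i, j)) \<longleftrightarrow> \<alpha> = 1 + \<beta>\<^sup>2 * (real v - 1) \<and> \<beta> = \<beta>\<^sub>s"
proof -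
  have v: "real v - 1 > 0" using v_gt by simp
  have "(\<beta> * (real v - 1) + r) * (\<beta> * r - 1) = 0 \<longleftrightarrow> \<beta> = \<beta>\<^sub>s"
  proof (cases "r > 0")
    case True
    then have "\<beta> * (real v - 1) + r > 0" using v assms by (simp add: add_pos_pos)
    then have "\<beta> * (real v - 1) + r \<noteq> 0" by simp
    then have "?thesis \<longleftrightarrow> (\<beta> * r - 1 = 0 \<longleftrightarrow> \<beta> = \<beta>\<^sub>s)"
      by (simp only: mult_eq_0_iff simp_thms)
    then show ?thesis using True by (simp add: \<beta>\<^sub>s_def field_simps)
  next
    case False
    then have "r < 0" using r_nonzero by simp
    then have "\<beta> * r - 1 < 0" using assms by (smt (verit) mult_pos_neg)
    then have "\<beta> * r - 1 \<noteq> 0" by simp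
    then have "?thesis \<longleftrightarrow> (\<beta> * (real v - 1) + r = 0 \<longleftrightarrow> \<beta> = \<beta>\<^sub>s)"
      by (simp only: mult_eq_0_iff simp_thms)
    moreover have "\<beta> = - r / (real v - 1) \<longleftrightarrow> \<beta> * (real v - 1) = - r"
      using v by (intro nonzero_eq_divide_eq) simp
    ultimately show ?thesis using False unfolding \<beta>\<^sub>s_def eq_neg_iff_add_eq_0 by argo
  qed
  then show ?thesis using assms unfolding srg_gram_square_iff by simp
qed

lemma realizes_exists: "\<exists>m. realizes v A \<beta>\<^sub>s m"
proof -
  let ?G = "srg_gram v \<beta>\<^sub>s A"
  let ?\<alpha> = "1 + \<beta>\<^sub>s\<^sup>2 * (real v - 1)"
  have pos: "?\<alpha> > 0" using v_gt by (simp add: add_pos_nonneg)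
  have diag: "?G $$ (i, i) = 1" if "i < v" for i
    using that by (simp add: srg_gram_index s_diag)
  have sym: "?G $$ (i, j) = ?G $$ (j, i)" if "i < v" "j < v" for i j
    using that by (auto simp: srg_gram_index s_sym)
  have equi: "\<bar>?G $$ (i, j)\<bar> = \<beta>\<^sub>s" if "i < v" "j < v" "i \<noteq> j" for i j
    using that abs_s[of i j] \<beta>_pos by (simp add: srg_gram_index abs_mult)
  have sq: "(\<Sum>t<v. ?G $$ (i, t) * ?G $$ (t, j)) = ?\<alpha> * ?G $$ (i, j)"
    if "i < v" "j < v" for i j
    using that srg_gram_square_pos_iff[OF \<beta>_pos, of ?\<alpha>] by simp
  obtain m \<phi> where "etf m v \<phi>" "gram m v \<phi> = ?G"
    by (rule etf_of_gram[OF srg_gram_carrier sym diag equi sq pos])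
  moreover have "m > 0" using etf_dim_pos[of m v \<phi>] v_gt \<open>etf m v \<phi>\<close> by simp
  ultimately show ?thesis using \<beta>_pos by (auto simp: realizes_def)
qed

section \<open>Parameters and centroidal symmetry of a realizing frame\<close>

context
  fixes \<beta> m \<phi>
  assumes \<beta>: "\<beta> > 0" and etf: "etf m v \<phi>" and gram: "gram m v \<phi> = srg_gram v \<beta> A"
begin

lemma v_pos: "0 < v"
  using v_gt by simp

lemma \<beta>_eq: "\<beta> = \<beta>\<^sub>s" and \<alpha>_eq: "real v / real m = 1 + \<beta>\<^sup>2 * (real v - 1)"
  using gram_square[OF etf_tight[OF etf v_pos]] srg_gram_square_pos_iff[OF \<beta>, of "real v / real m"]
  by (simp_all add: gram)

lemma \<beta>_welch: "\<beta> = welch m v"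
  by (rule equiangular_bound(2)[OF etf])
    (use v_gt \<beta> abs_s in \<open>auto simp: gram srg_gram_index abs_mult\<close>)

lemma m_pos: "0 < m"
  by (rule etf_dim_pos[OF etf v_pos])

lemma m_less: "m < v"
proof -
  have "real v / real m > 1" using \<beta> v_gt unfolding \<alpha>_eq by simp
  then show ?thesis using m_pos by (simp add: field_simps)
qed

lemma m_eq: "real m = real v / (1 + \<beta>\<^sup>2 * (real v - 1))"
  unfolding \<alpha>_eq[symmetric] using m_pos v_pos by simp

text \<open>Here \<beta> = 1 / r, so every row sum 1 - \<beta>r of G is zero.\<close>

lemma centered_case:
  assumes "r > 0"
  shows "centered m v \<phi>" "real m = real v * r\<^sup>2 / ((real v - 1) + r\<^sup>2)"
    "real v / real m = (real v - 1) / r\<^sup>2 + 1" "\<beta> = 1 / r"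
proof -
  show b: "\<beta> = 1 / r" using \<beta>_eq assms by (simp add: \<beta>\<^sub>s_def)
  show "real v / real m = (real v - 1) / r\<^sup>2 + 1"
    unfolding \<alpha>_eq b by (simp add: power_divide)
  show "real m = real v * r\<^sup>2 / ((real v - 1) + r\<^sup>2)"
    unfolding m_eq b using assms v_gt by (simp add: power_divide field_simps)
  show "centered m v \<phi>"
    using assms by (simp add: centered_iff_gram gram srg_gram_row_sum b)
qed

text \<open>With \<beta> = -r / (v - 1) the row sum 1 - \<beta>r equals the frame bound v / m, which
  is the Gram criterion for axiality.\<close>

lemma axial_case:
  assumes "r < 0"
  shows "axial m v \<phi>" "real m = real v * (real v - 1) / ((real v - 1) + r\<^sup>2)"
    "real v / real m = r\<^sup>2 / (real v - 1) + 1" "\<beta> = - r / (real v - 1)"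
proof -
  have v: "real v - 1 > 0" using v_gt by simp
  show b: "\<beta> = - r / (real v - 1)" using \<beta>_eq assms by (simp add: \<beta>\<^sub>s_def)
  have *: "1 + \<beta>\<^sup>2 * (real v - 1) = r\<^sup>2 / (real v - 1) + 1"
    unfolding b using v by (simp add: power_divide power2_eq_square)
  show alpha: "real v / real m = r\<^sup>2 / (real v - 1) + 1"
    unfolding \<alpha>_eq by (rule *)
  show "real m = real v * (real v - 1) / ((real v - 1) + r\<^sup>2)"
    unfolding m_eq * using v by (simp add: divide_simps)
  have "1 - \<beta> * r = real v / real m"
    unfolding alpha b by (simp add: power2_eq_square)
  then show "axial m v \<phi>"
    using m_pos v_pos axial_iff_gram[OF etf_tight[OF etf v_pos]]
    by (simp add: gram srg_gram_row_sum)
qed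

text \<open>Because \<beta> is the Welch value, the affine maps from A to G and from G back to A use
  the same constant and cancel.\<close>

lemma etf_srg_mat_eq: "etf_srg_mat m v \<phi> = A"
proof (rule eq_matI)
  fix i j assume "i < dim_row A" "j < dim_col A"
  then have ij: "i < v" "j < v" by auto
  show "etf_srg_mat m v \<phi> $$ (i, j) = a i j"
    using ij \<beta> unfolding etf_srg_mat_def \<beta>_welch[symmetric] gram
    by (simp add: srg_gram_def J_mat_def field_simps)
qed (simp_all add: etf_srg_mat_def J_mat_def)

lemma centroid_symmetric: "centroid_symmetric m v \<phi>"
  using centered_case(1) axial_case(1) r_nonzero unfolding centroid_symmetric_def by linarith

end

text \<open>\<beta> must be \<open>\<beta>\<^sub>s\<close>, which depends only on the graph, and
  \<beta> determines the frame bound v / m and hence m.\<close>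

lemma realizes_unique:
  assumes "realizes v A \<beta> m" "realizes v A \<beta>' m'"
  shows "\<beta> = \<beta>'" "m = m'"
proof -
  obtain \<phi> \<phi>' where p: "\<beta> > 0" "etf m v \<phi>" "gram m v \<phi> = srg_gram v \<beta> A"
    "\<beta>' > 0" "etf m' v \<phi>'" "gram m' v \<phi>' = srg_gram v \<beta>' A"
    using assms by (auto simp: realizes_def)
  show b: "\<beta> = \<beta>'" using \<beta>_eq[OF p(1-3)] \<beta>_eq[OF p(4-6)] by simp
  have "real m = real m'" using m_eq[OF p(1-3)] m_eq[OF p(4-6)] b by simp
  then show "m = m'" by simp
qed

end

lemma realizes_condition:
  assumes "realizes v A \<beta> m"
  shows "int v = 4 * int k - 2 * int l - 2 * int \<mu>"
proof -
  obtain \<phi> where \<beta>: "\<beta> > 0" and etf: "etf m v \<phi>" and g: "gram m v \<phi> = srg_gram v \<beta> A"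
    using assms by (auto simp: realizes_def)
  have "0 < v" using v_gt by simp
  then show ?thesis
    using \<beta> gram_square[OF etf_tight[OF etf]] unfolding g
    by (intro parameter_condition[of \<beta> "real v / real m"]) auto
qed

end

subsection \<open>From equiangular tight frames to strongly regular graphs\<close>

lemma etf_srg_mat_index:
  "i < n \<Longrightarrow> j < n \<Longrightarrow> etf_srg_mat m n \<phi> $$ (i, j)
    = gram m n \<phi> $$ (i, j) / (2 * welch m n)
      - (welch m n + 1) / (2 * welch m n) * (if i = j then 1 else 0) + 1 / 2"
  by (simp add: etf_srg_mat_def J_mat_def)

section \<open>The graph of a centroid-symmetric frame\<close>

locale centroid_symmetric_etf =
  fixes m n :: nat and \<phi> :: "nat \<Rightarrow> real vec"
  assumes etf: "etf m n \<phi>" and less: "m < n" and cs: "centroid_symmetric m n \<phi>"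
begin

abbreviation "w \<equiv> welch m n"
abbreviation "G \<equiv> \<lambda>i j. gram m n \<phi> $$ (i, j)"
abbreviation "\<alpha> \<equiv> real n / real m"

definition E :: "nat set set" where
  "E = {{i, j} |i j. i < n \<and> j < n \<and> i \<noteq> j \<and> G i j = w}"

lemma etf_pos: "0 < m" "1 < n" "\<alpha> > 1"
  using etf_dim_pos[OF etf] less by auto

lemma welch_pos: "0 < w"
  using etf_pos less by (simp add: welch_def)

lemma G_diag: "i < n \<Longrightarrow> G i i = 1"
  using etf by (simp add: etf_iff)

lemma G_abs:
  assumes "i < n" "j < n" "i \<noteq> j"
  shows "\<bar>G i j\<bar> = w"
proof -
  obtain c where c: "\<And>i j. i < n \<Longrightarrow> j < n \<Longrightarrow> i \<noteq> j \<Longrightarrow> \<bar>G i j\<bar> = c"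
    using etf by (auto simp: etf_iff)
  then have "0 \<le> c" using assms abs_ge_zero by metis
  then show ?thesis using equiangular_bound(2)[OF etf etf_pos(2) _ c] c assms by simp
qed

lemma edge_iff: "i < n \<Longrightarrow> j < n \<Longrightarrow> {i, j} \<in> E \<longleftrightarrow> i \<noteq> j \<and> G i j = w"
  using gram_symmetric[of i n j m \<phi>] by (auto simp: E_def doubleton_eq_iff)

text \<open>The affine map sends the off-diagonal values w and -w to 1 and 0, and the diagonal value
  1 to 0.\<close>

lemma etf_srg_mat_adj: "etf_srg_mat m n \<phi> = adj_mat n E"
proof (rule eq_matI)
  fix i j assume "i < dim_row (adj_mat n E)" "j < dim_col (adj_mat n E)"
  then have ij: "i < n" "j < n" by auto
  show "etf_srg_mat m n \<phi> $$ (i, j) = adj_mat n E $$ (i, j)"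
  proof (cases "i = j")
    case True
    then show ?thesis using ij welch_pos edge_iff[of i i]
      by (simp add: etf_srg_mat_index adj_mat_index edge_iff G_diag field_simps)
  next
    case False
    then have "G i j = w \<or> G i j = - w" using G_abs[of i j] ij by linarith
    then show ?thesis using ij False welch_pos
      by (auto simp: etf_srg_mat_index adj_mat_index edge_iff)
  qed
qed (simp_all add: etf_srg_mat_def J_mat_def)

lemma gram_eq_srg_gram: "gram m n \<phi> = srg_gram n w (etf_srg_mat m n \<phi>)"
  using welch_pos
  by (intro eq_matI) (auto simp: srg_gram_def etf_srg_mat_index J_mat_def field_simps etf_srg_mat_def)

lemma G_index: "i < n \<Longrightarrow> j < n \<Longrightarrow>
    G i j = 2 * w * adj_mat n E $$ (i, j) + (w + 1) * (if i = j then 1 else 0) - w"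
  by (subst gram_eq_srg_gram) (simp add: etf_srg_mat_adj srg_gram_def J_mat_def)

text \<open>Centroidal symmetry enters here: the row sums are all 0 or all n / m.\<close>

lemma G_row_sum_const: "\<exists>\<rho>. \<forall>i<n. (\<Sum>j<n. G i j) = \<rho>"
proof -
  have "0 < \<alpha>" using etf_pos by simp
  then have "(\<forall>i<n. (\<Sum>j<n. G i j) = 0) \<or> (\<forall>i<n. (\<Sum>j<n. G i j) = \<alpha>)"
    using cs axial_iff_gram[OF etf_tight[OF etf]] etf_pos
    by (auto simp: centroid_symmetric_def centered_iff_gram)
  then show ?thesis by blast
qed

text \<open>Row i of G sums to 2w deg(i) + (w + 1) - nw, so constant row sums and w > 0 give
  constant degree.\<close>

lemma regular: obtains k where "regular_graph n k E"
proof -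
  obtain \<rho> where \<rho>: "\<And>i. i < n \<Longrightarrow> (\<Sum>j<n. G i j) = \<rho>" using G_row_sum_const by blast
  let ?c = "\<lambda>i. card {j. j < n \<and> {i, j} \<in> E}"
  have n0: "0 < n" using etf_pos by simp
  have deg: "2 * w * real (?c i) + (w + 1) - real n * w = \<rho>" if "i < n" for i
    using \<rho>[OF that] that
    by (simp add: G_index sum.distrib sum_subtractf flip: sum_distrib_left adj_mat_row_sum)
  have deg0: "2 * w * real (?c i) = 2 * w * real (?c 0)" if "i < n" for i
    using deg[OF that] deg[OF n0] by linarith
  have "?c i = ?c 0" if "i < n" for i using deg0[OF that] welch_pos by simp
  then show ?thesis using that unfolding regular_graph_def by blast
qed

text \<open>Substituting G = 2wA + (w + 1)I - wJ into G G = (n/m) G and using AJ = JA = kJ, the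
  equation can be solved for the square of A, as w is nonzero.\<close>

lemma adj_square:
  assumes reg: "regular_graph n k E"
  shows "\<exists>x y z. \<forall>i<n. \<forall>j<n.
    (adj_mat n E * adj_mat n E) $$ (i, j) = x * adj_mat n E $$ (i, j) + y * (if i = j then 1 else 0) + z"
proof -
  let ?a = "\<lambda>i j. adj_mat n E $$ (i, j)"
  let ?d = "\<lambda>i j. if i = j then 1 else (0::real)"
  have row: "(\<Sum>t<n. ?a i t) = k" if "i < n" for i
    using that reg by (simp add: adj_mat_row_sum regular_graph_def)
  have col: "(\<Sum>t<n. ?a t j) = k" if "j < n" for j
    using that row[of j] by (simp add: adj_mat_index insert_commute)
  have AA: "(adj_mat n E * adj_mat n E) $$ (i, j) = (\<Sum>t<n. ?a i t * ?a t j)"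
    if "i < n" "j < n" for i j
    using that by (simp add: scalar_prod_def atLeast0LessThan)
  have divide: "S = p / c * b + q / c * d + z / c" if "c * S = p * b + q * d + z" "c \<noteq> 0"
    for S p q b c d z :: real
    using that by (simp add: field_simps)
  define \<gamma> where "\<gamma> = \<alpha>"
  have "4 * w\<^sup>2 * (\<Sum>t<n. ?a i t * ?a t j) = (2 * w * \<gamma> - 4 * w * (w + 1)) * ?a i j
      + ((w + 1) * \<gamma> - (w + 1)\<^sup>2) * ?d i j + (4 * w\<^sup>2 * k + 2 * w * (w + 1) - w\<^sup>2 * n - w * \<gamma>)"
    if i: "i < n" and j: "j < n" for i j
  proof -
    have "\<gamma> * G i j = (\<Sum>t<n. G i t * G t j)"
      using gram_square[OF etf_tight[OF etf] i j] etf_pos by (simp add: \<gamma>_def)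
    also have "\<dots> = (\<Sum>t<n. 4 * w\<^sup>2 * (?a i t * ?a t j) + (if t = j then 2 * w * (w + 1) * ?a i t else 0)
        - 2 * w\<^sup>2 * ?a i t + (if i = t then 2 * w * (w + 1) * ?a t j else 0)
        + (if i = t then (w + 1)\<^sup>2 * ?d t j else 0) - (if i = t then w * (w + 1) else 0)
        - 2 * w\<^sup>2 * ?a t j - (if t = j then w * (w + 1) else 0) + w\<^sup>2)"
      using i j by (intro sum.cong refl) (simp add: G_index algebra_simps power2_eq_square)
    also have "\<dots> = 4 * w\<^sup>2 * (\<Sum>t<n. ?a i t * ?a t j) + 2 * w * (w + 1) * ?a i j
        - 2 * w\<^sup>2 * (\<Sum>t<n. ?a i t) + 2 * w * (w + 1) * ?a i j + (w + 1)\<^sup>2 * ?d i j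
        - w * (w + 1) - 2 * w\<^sup>2 * (\<Sum>t<n. ?a t j) - w * (w + 1) + n * w\<^sup>2"
      using i j by (simp add: sum.distrib sum_subtractf sum_distrib_left)
    finally show ?thesis unfolding row[OF i] col[OF j] G_index[OF i j]
      by (cases "i = j") (simp_all add: algebra_simps power2_eq_square)
  qed
  then have "(adj_mat n E * adj_mat n E) $$ (i, j) = (2 * w * \<gamma> - 4 * w * (w + 1)) / (4 * w\<^sup>2) * ?a i j
      + ((w + 1) * \<gamma> - (w + 1)\<^sup>2) / (4 * w\<^sup>2) * ?d i j
      + (4 * w\<^sup>2 * k + 2 * w * (w + 1) - w\<^sup>2 * n - w * \<gamma>) / (4 * w\<^sup>2)"
    if "i < n" "j < n" for i j
    unfolding AA[OF that] using that welch_pos by (intro divide) auto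
  then show ?thesis by blast
qed

text \<open>
  The numbers \<open>l\<close> and \<open>\<mu>\<close> are read off as common-neighbour counts, so they are natural numbers
  even though the coefficients in \<open>adj_square\<close> are only known to be real; if there is no edge
  (or no nonedge), \<open>l\<close> (or \<open>\<mu>\<close>) is arbitrary.
\<close>

lemma srg_exists: obtains k l \<mu> where "srg n k l \<mu> E"
proof -
  obtain k where reg: "regular_graph n k E" by (rule regular)
  obtain x y z where sq: "\<And>i j. i < n \<Longrightarrow> j < n \<Longrightarrow>
    (adj_mat n E * adj_mat n E) $$ (i, j) = x * adj_mat n E $$ (i, j) + y * (if i = j then 1 else 0) + z"
    using adj_square[OF reg] by blast
  have "\<exists>l::nat. \<forall>i<n. \<forall>j<n. {i, j} \<in> E \<longrightarrow> (adj_mat n E * adj_mat n E) $$ (i, j) = real l"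
  proof (cases "\<exists>i<n. \<exists>j<n. {i, j} \<in> E")
    case True
    then obtain i j where ij: "i < n" "j < n" "{i, j} \<in> E" by blast
    obtain c :: nat where c: "(adj_mat n E * adj_mat n E) $$ (i, j) = real c"
      using adj_mat_square[OF ij(1,2)] by blast
    have "(adj_mat n E * adj_mat n E) $$ (i', j') = real c"
      if "i' < n" "j' < n" "{i', j'} \<in> E" for i' j'
      using that ij c edge_iff[of i j] edge_iff[of i' j'] unfolding sq[OF ij(1,2)] sq[OF that(1,2)]
      by (simp add: adj_mat_index)
    then show ?thesis by blast
  qed auto
  then obtain l :: nat where l: "\<And>i j. i < n \<Longrightarrow> j < n \<Longrightarrow> {i, j} \<in> E \<Longrightarrow>
      (adj_mat n E * adj_mat n E) $$ (i, j) = real l" by blast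
  have "\<exists>\<mu>::nat. \<forall>i<n. \<forall>j<n. i \<noteq> j \<and> {i, j} \<notin> E \<longrightarrow>
      (adj_mat n E * adj_mat n E) $$ (i, j) = real \<mu>"
  proof (cases "\<exists>i<n. \<exists>j<n. i \<noteq> j \<and> {i, j} \<notin> E")
    case True
    then obtain i j where ij: "i < n" "j < n" "i \<noteq> j" "{i, j} \<notin> E" by blast
    obtain c :: nat where c: "(adj_mat n E * adj_mat n E) $$ (i, j) = real c"
      using adj_mat_square[OF ij(1,2)] by blast
    have "(adj_mat n E * adj_mat n E) $$ (i', j') = real c"
      if "i' < n" "j' < n" "i' \<noteq> j'" "{i', j'} \<notin> E" for i' j'
      using that ij c unfolding sq[OF ij(1,2)] sq[OF that(1,2)] by (simp add: adj_mat_index)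
    then show ?thesis by blast
  qed auto
  then obtain \<mu> :: nat where \<mu>: "\<And>i j. i < n \<Longrightarrow> j < n \<Longrightarrow> i \<noteq> j \<Longrightarrow> {i, j} \<notin> E \<Longrightarrow>
      (adj_mat n E * adj_mat n E) $$ (i, j) = real \<mu>" by blast
  \<comment> \<open>Closed walks of length two at i correspond to its neighbours.\<close>
  have diag: "(adj_mat n E * adj_mat n E) $$ (i, i) = real k" if "i < n" for i
  proof -
    have "{t. t < n \<and> {i, t} \<in> E \<and> {t, i} \<in> E} = {t. t < n \<and> {i, t} \<in> E}"
      by (auto simp: insert_commute)
    then show ?thesis using that reg by (simp add: adj_mat_square regular_graph_def del: index_mult_mat)
  qed
  have "adj_mat n E * adj_mat n E = (real l - real \<mu>) \<cdot>\<^sub>m adj_mat n E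
      + (real k - real \<mu>) \<cdot>\<^sub>m 1\<^sub>m n + real \<mu> \<cdot>\<^sub>m J_mat n" (is "_ = ?R")
  proof (rule eq_matI)
    fix i j assume "i < dim_row ?R" "j < dim_col ?R"
    then have ij: "i < n" "j < n" by (auto simp: J_mat_def)
    have "?R $$ (i, j) = (if i = j then real k else if {i, j} \<in> E then real l else real \<mu>)"
      using ij edge_iff[of i j] by (simp add: J_mat_def adj_mat_index)
    then show "(adj_mat n E * adj_mat n E) $$ (i, j) = ?R $$ (i, j)"
      using l \<mu> diag ij by auto
  qed (simp_all add: J_mat_def)
  moreover have "simple_graph n E" by (auto simp: simple_graph_def E_def)
  ultimately show ?thesis using reg that by (auto simp: srg_def)
qed

lemma etf_srg_mat_srg_adjacency: "\<exists>k l \<mu>. srg_adjacency n k l \<mu> (etf_srg_mat m n \<phi>)"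
  using srg_exists unfolding srg_adjacency_def etf_srg_mat_adj by metis

text \<open>The frame realizes its own graph, so the parameter condition and uniqueness for graphs
  apply to it.\<close>

lemma realizes_etf_srg_mat: "realizes n (etf_srg_mat m n \<phi>) w m"
  unfolding realizes_def using welch_pos etf_pos etf gram_eq_srg_gram by blast

end

section \<open>Both conversions and their mutual inversion\<close>

theorem theorem4p4:
  shows
    "(\<forall>(v::nat) (k::nat) (l::nat) (\<mu>::nat) (A::real mat).
        srg_adjacency v k l \<mu> A \<and> 0 < k \<and> k < v - 1 \<longrightarrow>
          ((\<exists>\<beta> m. realizes v A \<beta> m) \<longleftrightarrow> int v = 4 * int k - 2 * int l - 2 * int \<mu>) \<and>
          (int v = 4 * int k - 2 * int l - 2 * int \<mu> \<longrightarrow>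
             (\<exists>!p. realizes v A (fst p) (snd p)) \<and>
             (\<forall>\<beta> m \<phi>.
                \<beta> > 0 \<and> m > 0 \<and> etf m v \<phi> \<and> gram m v \<phi> = srg_gram v \<beta> A \<longrightarrow>
                  (let r = real v - 2 * real k - 1 in
                    (r > 0 \<longrightarrow>
                       centered m v \<phi> \<and>
                       real m = real v * r\<^sup>2 / ((real v - 1) + r\<^sup>2) \<and>
                       tight_with_bound m v \<phi> (real v / real m) \<and>
                       real v / real m = (real v - 1) / r\<^sup>2 + 1 \<and>
                       \<beta> = welch m v \<and> \<beta> = 1 / r) \<and>
                    (r < 0 \<longrightarrow>
                       axial m v \<phi> \<and>
                       real m = real v * (real v - 1) / ((real v - 1) + r\<^sup>2) \<and>
                       tight_with_bound m v \<phi> (real v / real m) \<and>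
                       real v / real m = r\<^sup>2 / (real v - 1) + 1 \<and>
                       \<beta> = welch m v \<and> \<beta> = - r / (real v - 1))) \<and>
                  m < v \<and> centroid_symmetric m v \<phi> \<and>
                  etf_srg_mat m v \<phi> = A))) \<and>
     (\<forall>(m::nat) (n::nat) (\<phi>::nat \<Rightarrow> real vec).
        etf m n \<phi> \<and> m < n \<and> centroid_symmetric m n \<phi> \<longrightarrow>
          (\<exists>k l \<mu>. srg_adjacency n k l \<mu> (etf_srg_mat m n \<phi>)) \<and>
          (\<forall>k l \<mu>. srg_adjacency n k l \<mu> (etf_srg_mat m n \<phi>) \<and> 0 < k \<and> k < n - 1 \<longrightarrow>
             int n = 4 * int k - 2 * int l - 2 * int \<mu> \<and>
             (\<forall>\<beta> m'. realizes n (etf_srg_mat m n \<phi>) \<beta> m' \<longrightarrow>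
                srg_gram n \<beta> (etf_srg_mat m n \<phi>) = gram m n \<phi>)))"
proof (intro conjI allI impI)
  fix v k l \<mu> A
  assume "srg_adjacency v k l \<mu> A \<and> 0 < k \<and> k < v - 1"
  then interpret srg_entries v k l \<mu> A by unfold_locales auto
  let ?cond = "int v = 4 * int k - 2 * int l - 2 * int \<mu>"
  show "(\<exists>\<beta> m. realizes v A \<beta> m) \<longleftrightarrow> ?cond"
    using realizes_exists realizes_condition by blast
  show "\<exists>!p. realizes v A (fst p) (snd p)" if c: ?cond
  proof -
    obtain m where "realizes v A \<beta>\<^sub>s m" using realizes_exists[OF c] by blast
    then show ?thesis
      using realizes_unique[OF c] by (intro ex1I[of _ "(\<beta>\<^sub>s, m)"]) (auto intro: prod_eqI)
  qed
  fix \<beta> m \<phi>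
  assume c: ?cond and "\<beta> > 0 \<and> m > 0 \<and> etf m v \<phi> \<and> gram m v \<phi> = srg_gram v \<beta> A"
  then have p: "\<beta> > 0" "etf m v \<phi>" "gram m v \<phi> = srg_gram v \<beta> A" by auto
  have t: "tight_with_bound m v \<phi> (real v / real m)"
    using etf_tight[OF p(2)] v_gt by simp
  show "let r = real v - 2 * real k - 1 in
      (r > 0 \<longrightarrow>
         centered m v \<phi> \<and>
         real m = real v * r\<^sup>2 / ((real v - 1) + r\<^sup>2) \<and>
         tight_with_bound m v \<phi> (real v / real m) \<and>
         real v / real m = (real v - 1) / r\<^sup>2 + 1 \<and>
         \<beta> = welch m v \<and> \<beta> = 1 / r) \<and>
      (r < 0 \<longrightarrow>
         axial m v \<phi> \<and>
         real m = real v * (real v - 1) / ((real v - 1) + r\<^sup>2) \<and>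
         tight_with_bound m v \<phi> (real v / real m) \<and>
         real v / real m = r\<^sup>2 / (real v - 1) + 1 \<and>
         \<beta> = welch m v \<and> \<beta> = - r / (real v - 1))"
    unfolding Let_def r_def[symmetric]
    using t \<beta>_welch[OF c p] centered_case[OF c p] axial_case[OF c p] by blast
  show "m < v" "centroid_symmetric m v \<phi>" "etf_srg_mat m v \<phi> = A"
    using m_less[OF c p] centroid_symmetric[OF c p] etf_srg_mat_eq[OF c p] by auto
next
  fix m n \<phi>
  assume "etf m n \<phi> \<and> m < n \<and> centroid_symmetric m n \<phi>"
  then interpret F: centroid_symmetric_etf m n \<phi> by unfold_locales auto
  show "\<exists>k l \<mu>. srg_adjacency n k l \<mu> (etf_srg_mat m n \<phi>)"
    by (rule F.etf_srg_mat_srg_adjacency)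
  fix k l \<mu>
  assume "srg_adjacency n k l \<mu> (etf_srg_mat m n \<phi>) \<and> 0 < k \<and> k < n - 1"
  then interpret srg_entries n k l \<mu> "etf_srg_mat m n \<phi>" by unfold_locales auto
  show c: "int n = 4 * int k - 2 * int l - 2 * int \<mu>"
    by (rule realizes_condition[OF F.realizes_etf_srg_mat])
  fix \<beta> m' assume "realizes n (etf_srg_mat m n \<phi>) \<beta> m'"
  \<comment> \<open>The original frame is one realization, with the Welch value as its constant, so
    uniqueness forces the same constant on any other.\<close>
  then have "\<beta> = welch m n"
    using realizes_unique(1)[OF c _ F.realizes_etf_srg_mat] by blast
  then show "srg_gram n \<beta> (etf_srg_mat m n \<phi>) = gram m n \<phi>"
    using F.gram_eq_srg_gram by simp
qed

end
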